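(* Let $\gamma\in(0,1]$, $\alpha\in\mathbb{R}$ and $h\in Z\hat C^{\gamma}(\Delta_T^3;B_\alpha)$. Then, for every $\tau\in[0,T]$: if $\gamma\in(0,1)$, one has $$r^\tau_{\mathrm d}(h)\in C^{\gamma}(\Delta_\tau^2;B_\alpha),\qquad\delta r^\tau_{\mathrm d}(h)=h^\tau,$$ and the uniform estimate $\sup_{\tau\in[0,T]}\|r^\tau_{\mathrm d}(h)\|_{\gamma,\alpha;\tau}\le C_\gamma M_{\alpha,T}\|h\|_{\gamma,\alpha}$; if $\gamma=1$, one has $$r^\tau_{\mathrm d}(h)\in C^{1}_{\log}(\Delta_\tau^2;B_\alpha),\qquad\delta r^\tau_{\mathrm d}(h)=h^\tau,$$ and the uniform estimates $$\sup_{\tau\in[0,T]}\|r^\tau_{\mathrm d}(h)\|_{1,\log;\tau,\alpha}\le C_{1,T}M_{\alpha,T}\|h\|_{1,\alpha},$$ as well as, for every $\varepsilon\in(0,1)$, $$\sup_{\tau\in[0,T]}\|r^\tau_{\mathrm d}(h)\|_{1-\varepsilon,\alpha;\tau}\le C_{\varepsilon,T}M_{\alpha,T}\|h\|_{1,\alpha}.$$ The constants $C_\gamma, C_{1,T}, C_{\varepsilon,T}$ do not depend on $h$.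
   Context: Fix $T>0$. $(B_\alpha)_{\alpha\in\mathbb{R}}$ is a Banach scale, i.e. a family of Banach spaces such that for $\alpha\le\beta$ the embedding $B_\beta\hookrightarrow B_\alpha$ is continuous. $S=(S_t)_{t\ge0}$ is an analytic (in particular strongly continuous) semigroup of bounded linear operators acting on this scale, with $S_0=\mathrm{Id}$; for every $\alpha\in\mathbb{R}$, $\varepsilon\in(0,1)$ there is $C_{\alpha,\varepsilon,T}>0$ with $\|S_tx\|_{B_{\alpha+\varepsilon}}\le C_{\alpha,\varepsilon,T}t^{-\varepsilon}\|x\|_{B_\alpha}$ and $\|(S_t-\mathrm{Id})x\|_{B_\alpha}\le C_{\alpha,\varepsilon,T}t^{\varepsilon}\|x\|_{B_{\alpha+\varepsilon}}$ for all $t\in(0,T]$. $M_{\alpha,T}:=\sup_{0\le r\le T}\|S_r\|_{\mathcal L(B_\alpha,B_\alpha)}<\infty$. For $\tau\in[0,T]$, $\Delta_\tau^n:=\{(t_1,\dots,t_n)\in[0,\tau]^n:0\le t_n\le\dots\le t_1\le\tau\}$; $C(\Delta_\tau^n;B_\beta)$ denotes continuous maps; $(\delta g)_{t_1\dots t_{n+1}}:=\sum_{i=1}^{n+1}(-1)^ig_{t_1\dots\hat t_i\dots t_{n+1}}$ (for a path, $(\delta I)_{ts}=I_t-I_s$); on $C(\Delta_T^n;B_\alpha)$, $(\hat\delta g)_{t_1\dots t_{n+1}}:=(\delta g)_{t_1\dots t_{n+1}}-(S_{t_1-t_2}-\mathrm{Id})g_{t_2\dots t_{n+1}}$. Norms: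 for $g\in C(\Delta_\tau^2;B_\beta)$, $\|g\|_{\mu,\beta;\tau}:=\sup_{0\le s<t\le\tau}\|g_{ts}\|_{B_\beta}/|t-s|^\mu$ and $\|g\|_{1,\log;\tau,\beta}:=\sup_{0\le s<t\le\tau}\frac{\|g_{ts}\|_{B_\beta}}{|t-s|(1+|\log|t-s||)}$; $C^\mu(\Delta_\tau^2;B_\beta)$, $C^1_{\log}(\Delta_\tau^2;B_\beta)$ are the corresponding subsets of $C(\Delta_\tau^2;B_\beta)$ of finite norm. For $h\in C(\Delta_\tau^3;B_\beta)$, $\|h\|_{\mu,\beta;\tau}:=\inf\{\sum_{j=1}^m\sup_{0\le s<u<t\le\tau}\frac{\|h_{j,tus}\|_{B_\beta}}{|t-u|^{\rho_j}|u-s|^{\mu-\rho_j}}:h=\sum_{j=1}^mh_j,\ m\in\mathbb{N},\ 0<\rho_j<\mu\}$; $C^\mu(\Delta_\tau^3;B_\beta)$ is the set where it is finite; the index $\tau$ is dropped when $\tau=T$. $ZC^\mu(\Delta_\tau^3;B_\beta):=\ker(\delta)\cap C^\mu(\Delta_\tau^3;B_\beta)$ and $Z\hat C^\mu(\Delta_T^3;B_\alpha):=\ker(\hat\delta)\cap C^\mu(\Delta_T^3;B_\alpha)$. Dyadic operators: for $\gamma\in(0,1]$ let $\mathcal A^\gamma(\Delta_\tau^2;B_\beta):=\{A\in C(\Delta_\tau^2;B_\beta):\delta A\in C^\gamma(\Delta_\tau^3;B_\beta)\}$. Fix, for each $\tau$, a linear map $\mathcal I^{\mathrm d}_\tau:\mathcal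 A^\gamma(\Delta_\tau^2;B_\beta)\to C([0,\tau];B_\beta)$ (the normalized dyadic ordinary low-regularity sewing map, obtained from a dyadic recursion on $\bigcup_n\{k2^{-n}\tau:0\le k\le2^n\}$ and continuous extension; such maps exist) with the following properties for every $A$: $\mathcal I^{\mathrm d}_\tau(A)_0=0$; with $\mathcal R^{\mathrm d}_\tau(A):=A-\delta\mathcal I^{\mathrm d}_\tau(A)$ one has $\delta\mathcal R^{\mathrm d}_\tau(A)=\delta A$; if $\gamma\in(0,1)$, $\mathcal R^{\mathrm d}_\tau(A)\in C^\gamma(\Delta_\tau^2;B_\beta)$ with $\|\mathcal R^{\mathrm d}_\tau(A)\|_{\gamma,\beta;\tau}\le C_\gamma\|\delta A\|_{\gamma,\beta;\tau}$; if $\gamma=1$, $\mathcal R^{\mathrm d}_\tau(A)\in C^1_{\log}(\Delta_\tau^2;B_\beta)$ with $\|\mathcal R^{\mathrm d}_\tau(A)\|_{1,\log;\tau,\beta}\le C_T\|\delta A\|_{1,\beta;\tau}$ and $\|\mathcal R^{\mathrm d}_\tau(A)\|_{1-\varepsilon,\beta;\tau}\le C_{\varepsilon,T}\|\delta A\|_{1,\beta;\tau}$ for every $\varepsilon\in(0,1)$; the constants are independent of $\tau\in[0,T]$. For $k\in ZC^\gamma(\Delta_\tau^3;B_\beta)$ set $b^k_{ts}:=-k_{ts0}$ and $\Lambda^{\mathrm d}_\tau k:=\mathcal R^{\mathrm d}_\tau(b^k)$. Frozen defects: $h^\tau\in C(\Delta_\tau^3;B_\alpha)$ is $h^\tau_{tus}:=(\Theta_\tau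 h)_{tus}:=S_{\tau-t}h_{tus}$, which lies in $ZC^\gamma(\Delta_\tau^3;B_\alpha)$ when $h\in Z\hat C^\gamma(\Delta_T^3;B_\alpha)$. The dyadic frozen increments are $r^\tau_{\mathrm d}(h):=\Lambda^{\mathrm d}_\tau(h^\tau)$. *)

theory Defs
  imports "HOL-Analysis.Analysis"
begin

section \<open>Banach scales\<close>

text \<open>A Banach space is a pair of a linear subspace \<open>X\<close> of an ambient real vector space and a
  function \<open>N\<close> which is a complete norm on \<open>X\<close> (the values of \<open>N\<close> outside \<open>X\<close> are irrelevant).
  All members of a scale live in the same ambient space, so that the embeddings are inclusions.\<close>

definition banach_on :: "'a::real_vector set \<Rightarrow> ('a \<Rightarrow> real) \<Rightarrow> bool" where
  "banach_on X N \<longleftrightarrow> subspace X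
     \<and> (\<forall>x\<in>X. 0 \<le> N x \<and> (N x = 0 \<longleftrightarrow> x = 0))
     \<and> (\<forall>x\<in>X. \<forall>c. N (c *\<^sub>R x) = \<bar>c\<bar> * N x)
     \<and> (\<forall>x\<in>X. \<forall>y\<in>X. N (x + y) \<le> N x + N y)
     \<and> (\<forall>\<sigma>::nat \<Rightarrow> 'a. range \<sigma> \<subseteq> X
          \<and> (\<forall>e>0. \<exists>n0. \<forall>m\<ge>n0. \<forall>n\<ge>n0. N (\<sigma> m - \<sigma> n) < e)
          \<longrightarrow> (\<exists>l\<in>X. (\<lambda>n. N (\<sigma> n - l)) \<longlonglongrightarrow> 0))"

definition banach_scale :: "(real \<Rightarrow> 'a::real_vector set) \<Rightarrow> (real \<Rightarrow> 'a \<Rightarrow> real) \<Rightarrow> bool" where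
  "banach_scale B nrm \<longleftrightarrow> (\<forall>\<alpha>. banach_on (B \<alpha>) (nrm \<alpha>))
     \<and> (\<forall>\<alpha> \<beta>. \<alpha> \<le> \<beta> \<longrightarrow> B \<beta> \<subseteq> B \<alpha> \<and> (\<exists>C. \<forall>x\<in>B \<beta>. nrm \<alpha> x \<le> C * nrm \<beta> x))"

section \<open>Analytic semigroups\<close>

definition bounded_operator_on ::
    "'a::real_vector set \<Rightarrow> ('a \<Rightarrow> real) \<Rightarrow> ('a \<Rightarrow> 'a) \<Rightarrow> bool" where
  "bounded_operator_on X N f \<longleftrightarrow> f ` X \<subseteq> X
     \<and> (\<forall>x\<in>X. \<forall>y\<in>X. f (x + y) = f x + f y)
     \<and> (\<forall>x\<in>X. \<forall>c. f (c *\<^sub>R x) = c *\<^sub>R f x)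
     \<and> (\<exists>C. \<forall>x\<in>X. N (f x) \<le> C * N x)"

definition operator_norm_on :: "'a set \<Rightarrow> ('a \<Rightarrow> real) \<Rightarrow> ('a \<Rightarrow> 'a) \<Rightarrow> ennreal" where
  "operator_norm_on X N f = (SUP x\<in>{x\<in>X. N x \<le> 1}. ennreal (N (f x)))"

definition C0_semigroup_on ::
    "'a::real_vector set \<Rightarrow> ('a \<Rightarrow> real) \<Rightarrow> (real \<Rightarrow> 'a \<Rightarrow> 'a) \<Rightarrow> bool" where
  "C0_semigroup_on X N S \<longleftrightarrow> (\<forall>t\<ge>0. bounded_operator_on X N (S t))
     \<and> (\<forall>x\<in>X. S 0 x = x)
     \<and> (\<forall>s\<ge>0. \<forall>t\<ge>0. \<forall>x\<in>X. S (s + t) x = S s (S t x))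
     \<and> (\<forall>x\<in>X. ((\<lambda>t. N (S t x - x)) \<longlongrightarrow> 0) (at_right 0))"

text \<open>A \<open>C\<^sub>0\<close>-semigroup is analytic if it extends to a strongly continuous, holomorphic semigroup
  \<open>W z\<close> on an open sector around the positive half-line.  Since the spaces are real, \<open>W z\<close> acts on
  the complexification \<open>X + i X\<close>; it is the complex-linear operator given on \<open>X\<close> by
  \<open>W z x = U z x + i V z x\<close>, and \<open>a + i b\<close> below is the complex derivative of \<open>w \<mapsto> W w x\<close>
  at \<open>z\<close>.\<close>

definition analytic_semigroup_on ::
    "'a::real_vector set \<Rightarrow> ('a \<Rightarrow> real) \<Rightarrow> (real \<Rightarrow> 'a \<Rightarrow> 'a) \<Rightarrow> bool" where
  "analytic_semigroup_on X N S \<longleftrightarrow> C0_semigroup_on X N S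
     \<and> (\<exists>\<theta> U V. 0 < \<theta> \<and> \<theta> \<le> pi / 2 \<and>
         (let \<Sigma> = {z::complex. z \<noteq> 0 \<and> \<bar>Arg z\<bar> < \<theta>} in
            (\<forall>z\<in>\<Sigma>. bounded_operator_on X N (U z) \<and> bounded_operator_on X N (V z))
          \<and> (\<forall>t>0. \<forall>x\<in>X. U (complex_of_real t) x = S t x \<and> V (complex_of_real t) x = 0)
          \<and> (\<forall>z\<in>\<Sigma>. \<forall>w\<in>\<Sigma>. \<forall>x\<in>X.
                U (z + w) x = U z (U w x) - V z (V w x)
              \<and> V (z + w) x = U z (V w x) + V z (U w x))
          \<and> (\<forall>x\<in>X. ((\<lambda>z. N (U z x - x) + N (V z x)) \<longlongrightarrow> 0) (at 0 within \<Sigma>))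
          \<and> (\<forall>x\<in>X. \<forall>z\<in>\<Sigma>. \<exists>a\<in>X. \<exists>b\<in>X.
               ((\<lambda>w. (N (U w x - U z x - (Re (w - z) *\<^sub>R a - Im (w - z) *\<^sub>R b))
                    + N (V w x - V z x - (Re (w - z) *\<^sub>R b + Im (w - z) *\<^sub>R a)))
                     / cmod (w - z)) \<longlongrightarrow> 0) (at z within \<Sigma>))))"

definition smoothing_estimates ::
    "real \<Rightarrow> (real \<Rightarrow> 'a::real_vector set) \<Rightarrow> (real \<Rightarrow> 'a \<Rightarrow> real) \<Rightarrow> (real \<Rightarrow> 'a \<Rightarrow> 'a) \<Rightarrow> bool" where
  "smoothing_estimates T B nrm S \<longleftrightarrow> (\<forall>\<alpha>. \<forall>\<epsilon>\<in>{0<..<1}. \<exists>C>0. \<forall>t\<in>{0<..T}.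
        (\<forall>x\<in>B \<alpha>. S t x \<in> B (\<alpha> + \<epsilon>) \<and> nrm (\<alpha> + \<epsilon>) (S t x) \<le> C * t powr (- \<epsilon>) * nrm \<alpha> x)
      \<and> (\<forall>x\<in>B (\<alpha> + \<epsilon>). nrm \<alpha> (S t x - x) \<le> C * t powr \<epsilon> * nrm (\<alpha> + \<epsilon>) x))"

definition semigroup_bound ::
    "real \<Rightarrow> 'a set \<Rightarrow> ('a \<Rightarrow> real) \<Rightarrow> (real \<Rightarrow> 'a \<Rightarrow> 'a) \<Rightarrow> ennreal" where
  "semigroup_bound T X N S = (SUP r\<in>{0..T}. operator_norm_on X N (S r))"

section \<open>Increments\<close>

text \<open>A map on \<open>\<Delta>\<^sub>\<tau>\<^sup>n\<close> is represented by a function on lists \<open>[t\<^sub>1, \<dots>, t\<^sub>n]\<close>, of which only the values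
  on \<open>\<Delta>\<^sub>\<tau>\<^sup>n\<close> matter.  Paths are the case \<open>n = 1\<close>.\<close>

definition time_simplex :: "real \<Rightarrow> nat \<Rightarrow> real list set" where
  "time_simplex \<tau> n = {ts. length ts = n \<and> set ts \<subseteq> {0..\<tau>} \<and> sorted_wrt (\<ge>) ts}"

definition cont_maps ::
    "'a::real_vector set \<Rightarrow> ('a \<Rightarrow> real) \<Rightarrow> real \<Rightarrow> nat \<Rightarrow> (real list \<Rightarrow> 'a) set" where
  "cont_maps X N \<tau> n = {g. (\<forall>ts\<in>time_simplex \<tau> n. g ts \<in> X)
     \<and> (\<forall>ts\<in>time_simplex \<tau> n. \<forall>e>0. \<exists>d>0. \<forall>us\<in>time_simplex \<tau> n.
          (\<forall>i<n. \<bar>us ! i - ts ! i\<bar> < d) \<longrightarrow> N (g us - g ts) < e)}"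

text \<open>List positions start at 0, whence the exponent \<open>Suc i\<close>.\<close>

definition delta :: "(real list \<Rightarrow> 'a::real_vector) \<Rightarrow> real list \<Rightarrow> 'a" where
  "delta g ts = (\<Sum>i<length ts. (-1) ^ Suc i *\<^sub>R g (take i ts @ drop (Suc i) ts))"

definition delta_hat ::
    "(real \<Rightarrow> 'a \<Rightarrow> 'a) \<Rightarrow> (real list \<Rightarrow> 'a::real_vector) \<Rightarrow> real list \<Rightarrow> 'a" where
  "delta_hat S g ts = delta g ts - (S (ts ! 0 - ts ! 1) (g (tl ts)) - g (tl ts))"

lemma delta_path: "delta I [t, s] = I [t] - I [s]"
  by (simp add: delta_def numeral_2_eq_2)

lemma delta_2: "delta g [t, u, s] = - g [u, s] + g [t, s] - g [t, u]"
  by (simp add: delta_def numeral_eq_Suc)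

section \<open>Hoelder-type norms and spaces\<close>

text \<open>The norms take values in \<open>[0, \<infinity>]\<close>; the spaces consist of the continuous maps of finite norm.\<close>

definition norm2 :: "('a \<Rightarrow> real) \<Rightarrow> real \<Rightarrow> real \<Rightarrow> (real list \<Rightarrow> 'a) \<Rightarrow> ennreal" where
  "norm2 N \<mu> \<tau> g = (SUP (t, s)\<in>{(t, s). 0 \<le> s \<and> s < t \<and> t \<le> \<tau>}.
     ennreal (N (g [t, s]) / \<bar>t - s\<bar> powr \<mu>))"

definition norm_log :: "('a \<Rightarrow> real) \<Rightarrow> real \<Rightarrow> (real list \<Rightarrow> 'a) \<Rightarrow> ennreal" where
  "norm_log N \<tau> g = (SUP (t, s)\<in>{(t, s). 0 \<le> s \<and> s < t \<and> t \<le> \<tau>}.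
     ennreal (N (g [t, s]) / (\<bar>t - s\<bar> * (1 + \<bar>ln \<bar>t - s\<bar>\<bar>))))"

definition norm3 ::
    "'a::real_vector set \<Rightarrow> ('a \<Rightarrow> real) \<Rightarrow> real \<Rightarrow> real \<Rightarrow> (real list \<Rightarrow> 'a) \<Rightarrow> ennreal" where
  "norm3 X N \<mu> \<tau> h = Inf {(\<Sum>j=1..m. SUP (t, u, s)\<in>{(t, u, s). 0 \<le> s \<and> s < u \<and> u < t \<and> t \<le> \<tau>}.
          ennreal (N (hs j [t, u, s]) / (\<bar>t - u\<bar> powr \<rho> j * \<bar>u - s\<bar> powr (\<mu> - \<rho> j))))
      | (m::nat) hs \<rho>. (\<forall>j\<in>{1..m}. hs j \<in> cont_maps X N \<tau> 3 \<and> 0 < \<rho> j \<and> \<rho> j < \<mu>)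
          \<and> (\<forall>ts\<in>time_simplex \<tau> 3. h ts = (\<Sum>j=1..m. hs j ts))}"

definition holder2 ::
    "'a::real_vector set \<Rightarrow> ('a \<Rightarrow> real) \<Rightarrow> real \<Rightarrow> real \<Rightarrow> (real list \<Rightarrow> 'a) set" where
  "holder2 X N \<mu> \<tau> = {g \<in> cont_maps X N \<tau> 2. norm2 N \<mu> \<tau> g < \<infinity>}"

definition log_holder2 ::
    "'a::real_vector set \<Rightarrow> ('a \<Rightarrow> real) \<Rightarrow> real \<Rightarrow> (real list \<Rightarrow> 'a) set" where
  "log_holder2 X N \<tau> = {g \<in> cont_maps X N \<tau> 2. norm_log N \<tau> g < \<infinity>}"

definition holder3 ::
    "'a::real_vector set \<Rightarrow> ('a \<Rightarrow> real) \<Rightarrow> real \<Rightarrow> real \<Rightarrow> (real list \<Rightarrow> 'a) set" where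
  "holder3 X N \<mu> \<tau> = {h \<in> cont_maps X N \<tau> 3. norm3 X N \<mu> \<tau> h < \<infinity>}"

definition Z_hat_holder3 ::
    "(real \<Rightarrow> 'a \<Rightarrow> 'a) \<Rightarrow> 'a::real_vector set \<Rightarrow> ('a \<Rightarrow> real) \<Rightarrow> real \<Rightarrow> real
      \<Rightarrow> (real list \<Rightarrow> 'a) set" where
  "Z_hat_holder3 S X N \<mu> T = {h \<in> holder3 X N \<mu> T. \<forall>ts\<in>time_simplex T 4. delta_hat S h ts = 0}"

section \<open>Dyadic sewing and frozen increments\<close>

definition sewing_domain ::
    "'a::real_vector set \<Rightarrow> ('a \<Rightarrow> real) \<Rightarrow> real \<Rightarrow> real \<Rightarrow> (real list \<Rightarrow> 'a) set" where
  "sewing_domain X N \<gamma> \<tau> = {A \<in> cont_maps X N \<tau> 2. delta A \<in> holder3 X N \<gamma> \<tau>}"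

definition remainder ::
    "(real \<Rightarrow> (real list \<Rightarrow> 'a) \<Rightarrow> real list \<Rightarrow> 'a::real_vector)
      \<Rightarrow> real \<Rightarrow> (real list \<Rightarrow> 'a) \<Rightarrow> real list \<Rightarrow> 'a" where
  "remainder J \<tau> A = (\<lambda>ts. A ts - delta (J \<tau> A) ts)"

text \<open>\<open>J \<tau>\<close> is the dyadic sewing map on \<open>[0, \<tau>]\<close>.  The first clause says that it is well defined on
  maps on \<open>\<Delta>\<^sub>\<tau>\<^sup>2\<close>.  The constants \<open>C\<close> (used for \<open>\<gamma> < 1\<close>), \<open>C1\<close> and \<open>Ce \<epsilon>\<close> (used for \<open>\<gamma> = 1\<close>) are
  parameters, common to all \<open>\<tau>\<close>.\<close>

definition dyadic_sewing ::
    "real \<Rightarrow> 'a::real_vector set \<Rightarrow> ('a \<Rightarrow> real) \<Rightarrow> real \<Rightarrow> real \<Rightarrow> real \<Rightarrow> (real \<Rightarrow> real)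
      \<Rightarrow> (real \<Rightarrow> (real list \<Rightarrow> 'a) \<Rightarrow> real list \<Rightarrow> 'a) \<Rightarrow> bool" where
  "dyadic_sewing T X N \<gamma> C C1 Ce J \<longleftrightarrow> (\<forall>\<tau>\<in>{0..T}.
      (\<forall>A\<in>sewing_domain X N \<gamma> \<tau>. \<forall>A'\<in>sewing_domain X N \<gamma> \<tau>.
          (\<forall>ts\<in>time_simplex \<tau> 2. A ts = A' ts) \<longrightarrow> (\<forall>ts\<in>time_simplex \<tau> 1. J \<tau> A ts = J \<tau> A' ts))
    \<and> (\<forall>A\<in>sewing_domain X N \<gamma> \<tau>. \<forall>A'\<in>sewing_domain X N \<gamma> \<tau>. \<forall>a b. \<forall>ts\<in>time_simplex \<tau> 1.
          J \<tau> (\<lambda>us. a *\<^sub>R A us + b *\<^sub>R A' us) ts = a *\<^sub>R J \<tau> A ts + b *\<^sub>R J \<tau> A' ts)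
    \<and> (\<forall>A\<in>sewing_domain X N \<gamma> \<tau>.
          J \<tau> A \<in> cont_maps X N \<tau> 1
        \<and> J \<tau> A [0] = 0
        \<and> (\<forall>ts\<in>time_simplex \<tau> 3. delta (remainder J \<tau> A) ts = delta A ts)
        \<and> (\<gamma> < 1 \<longrightarrow>
              remainder J \<tau> A \<in> holder2 X N \<gamma> \<tau>
            \<and> norm2 N \<gamma> \<tau> (remainder J \<tau> A) \<le> ennreal C * norm3 X N \<gamma> \<tau> (delta A))
        \<and> (\<gamma> = 1 \<longrightarrow>
              remainder J \<tau> A \<in> log_holder2 X N \<tau>
            \<and> norm_log N \<tau> (remainder J \<tau> A) \<le> ennreal C1 * norm3 X N 1 \<tau> (delta A)
            \<and> (\<forall>\<epsilon>\<in>{0<..<1}. norm2 N (1 - \<epsilon>) \<tau> (remainder J \<tau> A)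
                  \<le> ennreal (Ce \<epsilon>) * norm3 X N 1 \<tau> (delta A)))))"

text \<open>\<open>b\<^sup>k\<^sub>t\<^sub>s = - k\<^sub>t\<^sub>s\<^sub>0\<close>\<close>

definition germ :: "(real list \<Rightarrow> 'a::real_vector) \<Rightarrow> real list \<Rightarrow> 'a" where
  "germ k = (\<lambda>ts. - k (ts @ [0]))"

definition dyadic_Lambda ::
    "(real \<Rightarrow> (real list \<Rightarrow> 'a) \<Rightarrow> real list \<Rightarrow> 'a::real_vector)
      \<Rightarrow> real \<Rightarrow> (real list \<Rightarrow> 'a) \<Rightarrow> real list \<Rightarrow> 'a" where
  "dyadic_Lambda J \<tau> k = remainder J \<tau> (germ k)"

definition frozen_defect ::
    "(real \<Rightarrow> 'a \<Rightarrow> 'a) \<Rightarrow> real \<Rightarrow> (real list \<Rightarrow> 'a) \<Rightarrow> real list \<Rightarrow> 'a" where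
  "frozen_defect S \<tau> h = (\<lambda>ts. S (\<tau> - hd ts) (h ts))"

definition frozen_increment ::
    "(real \<Rightarrow> 'a \<Rightarrow> 'a) \<Rightarrow> (real \<Rightarrow> (real list \<Rightarrow> 'a) \<Rightarrow> real list \<Rightarrow> 'a::real_vector)
      \<Rightarrow> real \<Rightarrow> (real list \<Rightarrow> 'a) \<Rightarrow> real list \<Rightarrow> 'a" where
  "frozen_increment S J \<tau> h = dyadic_Lambda J \<tau> (frozen_defect S \<tau> h)"

end

theory Submission
  imports Defs
begin

text \<open>Freezing replaces \<open>h\<close> by \<open>S\<^bsub>\<tau>-t\<^esub> h\<^sub>t\<^sub>u\<^sub>s\<close>, and its purpose is to trade the twisted coboundary for the
  ordinary one.  Indeed \<open>S\<^bsub>\<tau>-t\<^esub>\<close> applied to the \<open>\<delta>\<close>-hat cocycle identity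
  \<open>h\<^sub>t\<^sub>s\<^sub>r - h\<^sub>t\<^sub>u\<^sub>r + h\<^sub>t\<^sub>u\<^sub>s = S\<^bsub>t-u\<^esub> h\<^sub>u\<^sub>s\<^sub>r\<close> turns its right-hand side into \<open>S\<^bsub>\<tau>-u\<^esub> h\<^sub>u\<^sub>s\<^sub>r\<close> by the semigroup
  law, so that the frozen defect is closed under \<open>\<delta>\<close> (\<open>delta_frozen_defect\<close>).  A \<open>\<delta>\<close>-closed map on
  triples is the coboundary of its own germ \<open>b\<^sub>t\<^sub>s = - k\<^sub>t\<^sub>s\<^sub>0\<close> (\<open>delta_germ\<close>), and the sewing remainder
  has the same coboundary as the germ and is controlled by the norm of that coboundary.

  What is left is analysis of the frozen defect itself.  It is continuous because a semigroup
  that is strongly continuous and uniformly bounded acts jointly continuously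
  (\<open>frozen_defect_cont\<close>).  Its norm is at most \<open>M\<close> times that of \<open>h\<close>: freezing is linear and acts
  at each time triple by one operator of norm at most \<open>M\<close>, so it maps a decomposition of \<open>h\<close> to a
  decomposition of the frozen defect with the same exponents (\<open>norm3_frozen_defect_le\<close>).  Since
  neither \<open>M\<close> nor the sewing constants depend on \<open>\<tau>\<close>, the estimates are uniform in \<open>\<tau>\<close>.\<close>

section \<open>Triples in the simplex and norms of three-parameter maps\<close>

lemma time_simplex_mono: "\<tau> \<le> T \<Longrightarrow> ts \<in> time_simplex \<tau> n \<Longrightarrow> ts \<in> time_simplex T n"
  by (force simp: time_simplex_def)

lemma time_simplex_3E:
  assumes "ts \<in> time_simplex \<tau> 3"
  obtains t u s where "ts = [t, u, s]" "0 \<le> s" "s \<le> u" "u \<le> t" "t \<le> \<tau>"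
  using assms by (auto simp: time_simplex_def numeral_3_eq_3 length_Suc_conv)

lemma time_simplex_hd:
  assumes "ts \<in> time_simplex \<tau> n" "0 < n"
  shows "hd ts = ts ! 0" "0 \<le> ts ! 0" "ts ! 0 \<le> \<tau>"
  using assms by (auto simp: time_simplex_def hd_conv_nth neq_Nil_conv)

text \<open>The coboundary of a germ need agree with the given cocycle only on the simplex; these two
  congruence rules allow the one to be replaced by the other.\<close>

lemma cont_maps_cong:
  assumes "\<And>ts. ts \<in> time_simplex \<tau> n \<Longrightarrow> g ts = g' ts"
  shows "g \<in> cont_maps X N \<tau> n \<longleftrightarrow> g' \<in> cont_maps X N \<tau> n"
  using assms by (simp add: cont_maps_def cong: conj_cong)

lemma norm3_cong:
  assumes "\<And>ts. ts \<in> time_simplex \<tau> 3 \<Longrightarrow> h ts = h' ts"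
  shows "norm3 X N \<mu> \<tau> h = norm3 X N \<mu> \<tau> h'"
  using assms by (simp add: norm3_def cong: conj_cong)

text \<open>In \<open>ennreal\<close> a constant passes through an infimum except in the case \<open>0 * \<infinity>\<close>; finiteness of
  both factors excludes it.\<close>

lemma le_mult_Inf_ennreal:
  fixes c x :: ennreal
  assumes "Inf A < \<infinity>" "c < \<infinity>" and le: "\<And>a. a \<in> A \<Longrightarrow> x \<le> c * a"
  shows "x \<le> c * Inf A"
proof (cases "c = 0")
  case True
  \<comment> \<open>The bound \<open>x = 0\<close> comes from some member of \<open>A\<close>, and \<open>A\<close> is nonempty as \<open>Inf {}\<close> is infinite.\<close>
  moreover obtain a where "a \<in> A" using assms(1) by fastforce
  ultimately show ?thesis using le[of a] by simp
next
  case False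
  have c: "c \<noteq> top" using assms(2) by auto
  have "x / c \<le> Inf A"
  proof (rule Inf_greatest)
    fix a assume "a \<in> A"
    then show "x / c \<le> a"
      using le[of a] False by (intro divide_le_posI_ennreal) (auto simp: mult.commute zero_less_iff_neq_zero)
  qed
  then have "c * (x / c) \<le> c * Inf A" by (rule mult_left_mono) simp
  moreover have "c * (x / c) = x"
    using mult_divide_eq_ennreal[OF False c, of x] by (simp add: ennreal_times_divide mult.commute[of c])
  ultimately show ?thesis by simp
qed

section \<open>Germs of closed maps\<close>

lemma delta_3:
  "delta g [t, u, s, r] = - g [u, s, r] + g [t, s, r] - g [t, u, r] + g [t, u, s]"
  by (simp add: delta_def numeral_eq_Suc)

text \<open>Appending the base point \<open>0\<close> is a contracting homotopy of the \<open>\<delta>\<close>-complex: \<open>\<delta> k\<close> vanishes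
  at \<open>(t, u, s, 0)\<close>, and three of its four terms make up \<open>\<delta>\<close> of the germ.\<close>

lemma delta_germ:
  assumes closed: "\<And>ts. ts \<in> time_simplex \<tau> 4 \<Longrightarrow> delta k ts = 0"
    and "ts \<in> time_simplex \<tau> 3"
  shows "delta (germ k) ts = k ts"
proof -
  obtain t u s where ts: "ts = [t, u, s]" "0 \<le> s" "s \<le> u" "u \<le> t" "t \<le> \<tau>"
    using time_simplex_3E assms(2) by metis
  then have "[t, u, s, 0] \<in> time_simplex \<tau> 4" by (simp add: time_simplex_def)
  then have "- k [u, s, 0] + k [t, s, 0] - k [t, u, 0] + k [t, u, s] = 0"
    using closed delta_3[of k t u s 0] by auto
  then show ?thesis by (simp add: ts delta_2 germ_def algebra_simps)
qed

section \<open>Freezing with a uniformly bounded semigroup\<close>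

locale bounded_C0_semigroup =
  fixes T :: real and X :: "'a::real_vector set" and N :: "'a \<Rightarrow> real" and S :: "real \<Rightarrow> 'a \<Rightarrow> 'a"
  assumes banach: "banach_on X N"
    and C0: "C0_semigroup_on X N S"
    and finite_bound: "semigroup_bound T X N S < \<infinity>"
begin

abbreviation M :: real where "M \<equiv> enn2real (semigroup_bound T X N S)"

lemma ennreal_M: "ennreal M = semigroup_bound T X N S"
  using finite_bound by simp

lemma X_subspace: "subspace X"
  and N_nonneg: "x \<in> X \<Longrightarrow> 0 \<le> N x"
  and N_eq_0: "x \<in> X \<Longrightarrow> N x = 0 \<longleftrightarrow> x = 0"
  and N_scale: "x \<in> X \<Longrightarrow> N (c *\<^sub>R x) = \<bar>c\<bar> * N x"
  and N_triangle: "x \<in> X \<Longrightarrow> y \<in> X \<Longrightarrow> N (x + y) \<le> N x + N y"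
  using banach by (simp_all add: banach_on_def)

lemmas X_closed = subspace_0[OF X_subspace] subspace_add[OF X_subspace] subspace_diff[OF X_subspace]
  subspace_scale[OF X_subspace] subspace_neg[OF X_subspace]

lemma N_minus: "x \<in> X \<Longrightarrow> N (- x) = N x"
  using N_scale[of x "-1"] by simp

lemma S_bounded: "0 \<le> r \<Longrightarrow> bounded_operator_on X N (S r)"
  using C0 by (simp add: C0_semigroup_on_def)

lemma S_in: "0 \<le> r \<Longrightarrow> x \<in> X \<Longrightarrow> S r x \<in> X"
  and S_add: "0 \<le> r \<Longrightarrow> x \<in> X \<Longrightarrow> y \<in> X \<Longrightarrow> S r (x + y) = S r x + S r y"
  and S_scale: "0 \<le> r \<Longrightarrow> x \<in> X \<Longrightarrow> S r (c *\<^sub>R x) = c *\<^sub>R S r x"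
  using S_bounded[of r] by (auto simp: bounded_operator_on_def)

lemma S_S: "0 \<le> r \<Longrightarrow> 0 \<le> q \<Longrightarrow> x \<in> X \<Longrightarrow> S r (S q x) = S (r + q) x"
  using C0 by (simp add: C0_semigroup_on_def)

lemma S_0: "0 \<le> r \<Longrightarrow> S r 0 = 0"
  using S_scale[of r 0 0] X_closed(1) by simp

lemma S_diff: "0 \<le> r \<Longrightarrow> x \<in> X \<Longrightarrow> y \<in> X \<Longrightarrow> S r (x - y) = S r x - S r y"
  using S_add[of r x "(-1) *\<^sub>R y"] S_scale[of r y "-1"] X_closed(5)[of y] by simp

lemma S_sum: "0 \<le> r \<Longrightarrow> (\<And>j. j \<in> A \<Longrightarrow> f j \<in> X) \<Longrightarrow> S r (\<Sum>j\<in>A. f j) = (\<Sum>j\<in>A. S r (f j))"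
  by (induction A rule: infinite_finite_induct) (simp_all add: S_0 S_add subspace_sum[OF X_subspace])

lemma N_S_le:
  assumes r: "0 \<le> r" "r \<le> T" and x: "x \<in> X"
  shows "N (S r x) \<le> M * N x"
proof (cases "x = 0")
  case True
  then show ?thesis using r S_0 N_eq_0[of 0] X_closed(1) by simp
next
  case False
  then have pos: "0 < N x" using N_nonneg N_eq_0 x by (metis less_eq_real_def)
  define y where "y = (1 / N x) *\<^sub>R x"
  have y: "y \<in> X" "N y = 1" using x pos X_closed(4) by (simp_all add: y_def N_scale)
  have "ennreal (N (S r y)) \<le> operator_norm_on X N (S r)"
    unfolding operator_norm_on_def by (rule SUP_upper) (use y in simp)
  also have "\<dots> \<le> semigroup_bound T X N S"
    unfolding semigroup_bound_def by (rule SUP_upper) (use r in simp)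
  finally have "ennreal (N (S r y)) \<le> ennreal M" by (simp only: ennreal_M)
  then have "N (S r y) \<le> M" by (simp only: ennreal_le_iff enn2real_nonneg)
  moreover have "N (S r y) = N (S r x) / N x"
    using x r pos S_in by (simp add: y_def S_scale N_scale)
  ultimately show ?thesis using pos by (simp add: field_simps)
qed

text \<open>Uniform boundedness upgrades continuity at time \<open>0\<close> to continuity from both sides:
  \<open>S\<^sub>q - S\<^sub>r = S\<^sub>r (S\<^bsub>q-r\<^esub> - Id)\<close> for the smaller time \<open>r\<close>.\<close>

lemma strongly_continuous:
  assumes x: "x \<in> X" and e: "0 < e"
  obtains d where "0 < d"
    "\<And>r q. r \<in> {0..T} \<Longrightarrow> q \<in> {0..T} \<Longrightarrow> \<bar>q - r\<bar> < d \<Longrightarrow> N (S q x - S r x) < e"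
proof -
  have M0: "0 < M + 1" by (simp add: add_nonneg_pos)
  have "((\<lambda>t. N (S t x - x)) \<longlongrightarrow> 0) (at_right 0)" "S 0 x = x"
    using C0 x by (simp_all add: C0_semigroup_on_def)
  then obtain d where d: "0 < d" "\<And>y. 0 < y \<Longrightarrow> y < d \<Longrightarrow> N (S y x - x) < e / (M + 1)"
    using order_tendstoD(2)[of _ 0 "at_right 0" "e / (M + 1)"] e M0
    by (force simp: eventually_at_right_field)
  have less: "N (S q x - S r x) < e" if rq: "0 \<le> r" "r \<le> q" "q \<le> T" "q - r < d" for r q
  proof (cases "r = q")
    case True
    then show ?thesis using e N_eq_0[of 0] X_closed(1) by simp
  next
    case False
    let ?y = "S (q - r) x - x"
    have y: "?y \<in> X" using x rq by (simp add: S_in X_closed)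
    have "S q x - S r x = S r ?y" using x rq by (simp add: S_diff S_in S_S)
    also have "N \<dots> \<le> M * N ?y" using N_S_le y rq by simp
    also have "\<dots> \<le> (M + 1) * N ?y" using N_nonneg[OF y] by (simp add: mult_right_mono)
    also have "\<dots> < e" using d(2)[of "q - r"] rq False M0 by (simp add: field_simps)
    finally show ?thesis .
  qed
  have "N (S q x - S r x) < e" if rq: "r \<in> {0..T}" "q \<in> {0..T}" "\<bar>q - r\<bar> < d" for r q
  proof (cases "r \<le> q")
    case True
    then show ?thesis using less rq by simp
  next
    case False
    then have "N (S r x - S q x) < e" using less rq by simp
    then show ?thesis using N_minus[of "S r x - S q x"] x rq by (simp add: S_in X_closed)
  qed
  then show ?thesis using that d(1) by blast
qed

text \<open>The difference \<open>S\<^sub>q y - S\<^sub>r x\<close> splits into \<open>S\<^sub>q (y - x)\<close>, controlled by the uniform bound, and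
  \<open>S\<^sub>q x - S\<^sub>r x\<close>, controlled by strong continuity at the fixed vector \<open>x\<close>.\<close>

lemma frozen_defect_cont:
  assumes \<tau>: "\<tau> \<in> {0..T}" and n: "0 < n" and g: "g \<in> cont_maps X N T n"
  shows "frozen_defect S \<tau> g \<in> cont_maps X N \<tau> n"
  unfolding cont_maps_def
proof (intro CollectI conjI ballI allI impI)
  have M0: "0 < M + 1" by (simp add: add_nonneg_pos)
  have hd: "\<tau> - hd ts \<in> {0..T}" if "ts \<in> time_simplex \<tau> n" for ts
    using time_simplex_hd[OF that n] \<tau> by auto
  have gX: "g ts \<in> X" if "ts \<in> time_simplex \<tau> n" for ts
    using g that time_simplex_mono[of \<tau> T] \<tau> by (auto simp: cont_maps_def)
  show "frozen_defect S \<tau> g ts \<in> X" if "ts \<in> time_simplex \<tau> n" for ts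
    using S_in gX hd that by (auto simp: frozen_defect_def)
  fix ts e assume ts: "ts \<in> time_simplex \<tau> n" and e: "(0::real) < e"
  have "\<forall>e>0. \<exists>d>0. \<forall>us\<in>time_simplex T n. (\<forall>i<n. \<bar>us ! i - ts ! i\<bar> < d) \<longrightarrow> N (g us - g ts) < e"
    using g ts time_simplex_mono[of \<tau> T] \<tau> by (auto simp: cont_maps_def)
  moreover have "0 < e / (2 * (M + 1))" using e M0 by simp
  ultimately obtain d1 where d1: "0 < d1"
    "\<And>us. us \<in> time_simplex T n \<Longrightarrow> \<forall>i<n. \<bar>us ! i - ts ! i\<bar> < d1 \<Longrightarrow> N (g us - g ts) < e / (2 * (M + 1))"
    by meson
  obtain d2 where d2: "0 < d2"
    "\<And>r q. r \<in> {0..T} \<Longrightarrow> q \<in> {0..T} \<Longrightarrow> \<bar>q - r\<bar> < d2 \<Longrightarrow> N (S q (g ts) - S r (g ts)) < e / 2"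
    using strongly_continuous[OF gX[OF ts], of "e / 2"] e by auto
  have "N (frozen_defect S \<tau> g us - frozen_defect S \<tau> g ts) < e"
    if us: "us \<in> time_simplex \<tau> n" "\<forall>i<n. \<bar>us ! i - ts ! i\<bar> < min d1 d2" for us
  proof -
    let ?q = "\<tau> - hd us" and ?r = "\<tau> - hd ts"
    have q: "0 \<le> ?q" "?q \<le> T" and r: "0 \<le> ?r" using hd us ts by auto
    have diff: "g us - g ts \<in> X" using gX us ts X_closed by simp
    have "N (S ?q (g us - g ts)) \<le> M * N (g us - g ts)" using N_S_le diff q by simp
    also have "\<dots> \<le> (M + 1) * N (g us - g ts)" using N_nonneg[OF diff] by (simp add: mult_right_mono)
    also have "\<dots> < e / 2"
      using d1(2)[of us] us time_simplex_mono[of \<tau> T us n] \<tau> M0 by (simp add: field_simps)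
    finally have 1: "N (S ?q (g us - g ts)) < e / 2" .
    have "\<bar>?q - ?r\<bar> < d2"
      using us n time_simplex_hd(1)[OF us(1) n] time_simplex_hd(1)[OF ts n] by (auto simp: abs_minus_commute)
    then have 2: "N (S ?q (g ts) - S ?r (g ts)) < e / 2" using d2 hd us ts by blast
    have "frozen_defect S \<tau> g us - frozen_defect S \<tau> g ts
        = S ?q (g us - g ts) + (S ?q (g ts) - S ?r (g ts))"
      using q gX us ts by (simp add: frozen_defect_def S_diff)
    moreover have "N \<dots> \<le> N (S ?q (g us - g ts)) + N (S ?q (g ts) - S ?r (g ts))"
      using q r gX us ts diff by (intro N_triangle) (simp_all add: S_in X_closed)
    ultimately show ?thesis using 1 2 by simp
  qed
  then show "\<exists>d>0. \<forall>us\<in>time_simplex \<tau> n. (\<forall>i<n. \<bar>us ! i - ts ! i\<bar> < d)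
      \<longrightarrow> N (frozen_defect S \<tau> g us - frozen_defect S \<tau> g ts) < e"
    using d1(1) d2(1) by (intro exI[of _ "min d1 d2"]) auto
qed

text \<open>The norm is an infimum over decompositions, so it suffices to freeze every summand of a given
  decomposition of \<open>h\<close>: within each time triple the operator is the same for all summands, whence
  linearity yields a decomposition of the frozen defect, and each quotient grows by at most \<open>M\<close>.\<close>

lemma norm3_frozen_defect_le:
  assumes \<tau>: "\<tau> \<in> {0..T}" and fin: "norm3 X N \<mu> T h < \<infinity>"
  shows "norm3 X N \<mu> \<tau> (frozen_defect S \<tau> h) \<le> semigroup_bound T X N S * norm3 X N \<mu> T h"
  unfolding norm3_def[of _ _ _ T]
proof (rule le_mult_Inf_ennreal[OF fin[unfolded norm3_def] finite_bound])
  let ?tri = "\<lambda>\<tau>. {(t, u, s). 0 \<le> s \<and> s < u \<and> u < t \<and> t \<le> \<tau>}"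
  fix a
  assume "a \<in> {(\<Sum>j=1..m. SUP (t, u, s)\<in>?tri T.
          ennreal (N (hs j [t, u, s]) / (\<bar>t - u\<bar> powr \<rho> j * \<bar>u - s\<bar> powr (\<mu> - \<rho> j))))
      | (m::nat) hs \<rho>. (\<forall>j\<in>{1..m}. hs j \<in> cont_maps X N T 3 \<and> 0 < \<rho> j \<and> \<rho> j < \<mu>)
          \<and> (\<forall>ts\<in>time_simplex T 3. h ts = (\<Sum>j=1..m. hs j ts))}"
  then obtain m :: nat and hs \<rho> where
    a: "a = (\<Sum>j=1..m. SUP (t, u, s)\<in>?tri T.
          ennreal (N (hs j [t, u, s]) / (\<bar>t - u\<bar> powr \<rho> j * \<bar>u - s\<bar> powr (\<mu> - \<rho> j))))"
    and hs: "\<forall>j\<in>{1..m}. hs j \<in> cont_maps X N T 3 \<and> 0 < \<rho> j \<and> \<rho> j < \<mu>"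
    and h: "\<forall>ts\<in>time_simplex T 3. h ts = (\<Sum>j=1..m. hs j ts)"
    by (elim CollectE exE conjE) (rule that)
  let ?ks = "\<lambda>j. frozen_defect S \<tau> (hs j)"
  have "frozen_defect S \<tau> h ts = (\<Sum>j=1..m. ?ks j ts)" if ts: "ts \<in> time_simplex \<tau> 3" for ts
  proof -
    have tsT: "ts \<in> time_simplex T 3" using ts \<tau> time_simplex_mono by auto
    have "0 \<le> \<tau> - hd ts" using time_simplex_hd[OF ts] by simp
    moreover have "hs j ts \<in> X" if "j \<in> {1..m}" for j
      using bspec[OF hs that] tsT by (auto simp: cont_maps_def)
    ultimately show ?thesis unfolding frozen_defect_def bspec[OF h tsT] by (rule S_sum)
  qed
  moreover have "\<forall>j\<in>{1..m}. ?ks j \<in> cont_maps X N \<tau> 3 \<and> 0 < \<rho> j \<and> \<rho> j < \<mu>"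
    using hs frozen_defect_cont[OF \<tau>] by simp
  ultimately have "norm3 X N \<mu> \<tau> (frozen_defect S \<tau> h)
      \<le> (\<Sum>j=1..m. SUP (t, u, s)\<in>?tri \<tau>.
          ennreal (N (?ks j [t, u, s]) / (\<bar>t - u\<bar> powr \<rho> j * \<bar>u - s\<bar> powr (\<mu> - \<rho> j))))"
    unfolding norm3_def by (intro Inf_lower CollectI exI conjI) auto
  also have "\<dots> \<le> (\<Sum>j=1..m. semigroup_bound T X N S * (SUP (t, u, s)\<in>?tri T.
          ennreal (N (hs j [t, u, s]) / (\<bar>t - u\<bar> powr \<rho> j * \<bar>u - s\<bar> powr (\<mu> - \<rho> j)))))"
  proof (intro sum_mono SUP_least, clarify)
    fix j t u s assume j: "j \<in> {1..m}" and tus: "(0::real) \<le> s" "s < u" "u < t" "t \<le> \<tau>"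
    let ?D = "\<bar>t - u\<bar> powr \<rho> j * \<bar>u - s\<bar> powr (\<mu> - \<rho> j)"
    have "[t, u, s] \<in> time_simplex T 3" using tus \<tau> by (simp add: time_simplex_def)
    then have hX: "hs j [t, u, s] \<in> X" using bspec[OF hs j] by (auto simp: cont_maps_def)
    then have "N (?ks j [t, u, s]) \<le> M * N (hs j [t, u, s])"
      using N_S_le tus \<tau> by (simp add: frozen_defect_def)
    then have "N (?ks j [t, u, s]) / ?D \<le> M * (N (hs j [t, u, s]) / ?D)"
      by (simp add: divide_right_mono)
    then have "ennreal (N (?ks j [t, u, s]) / ?D) \<le> ennreal (M * (N (hs j [t, u, s]) / ?D))"
      by (rule ennreal_leI)
    also have "\<dots> = ennreal M * ennreal (N (hs j [t, u, s]) / ?D)"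
      by (rule ennreal_mult') simp
    also have "\<dots> \<le> ennreal M * (SUP (t, u, s)\<in>?tri T.
          ennreal (N (hs j [t, u, s]) / (\<bar>t - u\<bar> powr \<rho> j * \<bar>u - s\<bar> powr (\<mu> - \<rho> j))))"
      using tus \<tau> by (intro mult_left_mono SUP_upper2[of "(t, u, s)"]) auto
    finally show "ennreal (N (?ks j [t, u, s]) / ?D) \<le> semigroup_bound T X N S * (SUP (t, u, s)\<in>?tri T.
          ennreal (N (hs j [t, u, s]) / (\<bar>t - u\<bar> powr \<rho> j * \<bar>u - s\<bar> powr (\<mu> - \<rho> j))))"
      by (simp only: ennreal_M)
  qed
  also have "\<dots> = semigroup_bound T X N S * a" by (simp add: a sum_distrib_left)
  finally show "norm3 X N \<mu> \<tau> (frozen_defect S \<tau> h) \<le> semigroup_bound T X N S * a" .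
qed

text \<open>Only the term of \<open>\<delta>\<close> that drops the first time is frozen differently from the others; the
  twist in \<open>\<delta>\<close>-hat compensates exactly for this, as \<open>(\<tau> - t) + (t - u) = \<tau> - u\<close>.\<close>

lemma delta_frozen_defect:
  assumes \<tau>: "\<tau> \<in> {0..T}" and h: "h \<in> Z_hat_holder3 S X N \<mu> T" and ts: "ts \<in> time_simplex \<tau> 4"
  shows "delta (frozen_defect S \<tau> h) ts = 0"
proof -
  obtain t u s r where tsr: "ts = [t, u, s, r]" "0 \<le> r" "r \<le> s" "s \<le> u" "u \<le> t" "t \<le> \<tau>"
    using ts by (auto simp: time_simplex_def numeral_eq_Suc length_Suc_conv)
  have X: "h [a, b, c] \<in> X" if "0 \<le> c" "c \<le> b" "b \<le> a" "a \<le> \<tau>" for a b c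
    using h \<tau> that by (auto simp: Z_hat_holder3_def holder3_def cont_maps_def time_simplex_def)
  have "delta_hat S h ts = 0"
    using h ts \<tau> time_simplex_mono[of \<tau> T] by (auto simp: Z_hat_holder3_def)
  then have cocycle: "S (t - u) (h [u, s, r]) = h [t, s, r] - h [t, u, r] + h [t, u, s]"
    by (simp add: tsr delta_hat_def delta_3 algebra_simps)
  have "S (\<tau> - u) (h [u, s, r]) = S (\<tau> - t) (S (t - u) (h [u, s, r]))"
    using tsr X by (simp add: S_S)
  also have "\<dots> = S (\<tau> - t) (h [t, s, r]) - S (\<tau> - t) (h [t, u, r]) + S (\<tau> - t) (h [t, u, s])"
    using tsr X by (simp add: cocycle S_add S_diff X_closed)
  finally show ?thesis by (simp add: tsr delta_3 frozen_defect_def)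
qed

lemma germ_cont:
  assumes "0 \<le> \<tau>" and k: "k \<in> cont_maps X N \<tau> 3"
  shows "germ k \<in> cont_maps X N \<tau> 2"
proof -
  have app: "ts @ [0] \<in> time_simplex \<tau> 3" if "ts \<in> time_simplex \<tau> 2" for ts
    using that assms(1) by (auto simp: time_simplex_def sorted_wrt_append)
  have near: "\<forall>i<3. \<bar>(us @ [0]) ! i - (ts @ [0]) ! i\<bar> < d"
    if "ts \<in> time_simplex \<tau> 2" "us \<in> time_simplex \<tau> 2" "\<forall>i<2. \<bar>us ! i - ts ! i\<bar> < d" "0 < d"
    for ts us and d :: real
    using that by (auto simp: time_simplex_def nth_append less_Suc_eq numeral_3_eq_3)
  have kX: "k (ts @ [0]) \<in> X" if "ts \<in> time_simplex \<tau> 2" for ts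
    using k app[OF that] by (auto simp: cont_maps_def)
  have N: "N (germ k us - germ k ts) = N (k (us @ [0]) - k (ts @ [0]))"
    if "ts \<in> time_simplex \<tau> 2" "us \<in> time_simplex \<tau> 2" for ts us
    using N_minus[of "k (us @ [0]) - k (ts @ [0])"] kX that by (simp add: germ_def X_closed)
  show ?thesis
    unfolding cont_maps_def
  proof (intro CollectI conjI ballI allI impI)
    show "germ k ts \<in> X" if "ts \<in> time_simplex \<tau> 2" for ts
      using kX that by (simp add: germ_def X_closed)
    fix ts e assume ts: "ts \<in> time_simplex \<tau> 2" and "(0::real) < e"
    then obtain d where d: "0 < d" "\<And>us. us \<in> time_simplex \<tau> 3 \<Longrightarrow>
        \<forall>i<3. \<bar>us ! i - (ts @ [0]) ! i\<bar> < d \<Longrightarrow> N (k us - k (ts @ [0])) < e"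
      using k app[OF ts] unfolding cont_maps_def by blast
    have "N (germ k us - germ k ts) < e"
      if "us \<in> time_simplex \<tau> 2" "\<forall>i<2. \<bar>us ! i - ts ! i\<bar> < d" for us
      using d(2)[OF app near] N ts that d(1) by simp
    then show "\<exists>d>0. \<forall>us\<in>time_simplex \<tau> 2. (\<forall>i<2. \<bar>us ! i - ts ! i\<bar> < d)
        \<longrightarrow> N (germ k us - germ k ts) < e"
      using d(1) by blast
  qed
qed

text \<open>The germ of the frozen defect is thus an admissible input of the sewing map, with data
  bounded uniformly in \<open>\<tau>\<close>.\<close>

lemma frozen_germ:
  assumes \<tau>: "\<tau> \<in> {0..T}" and h: "h \<in> Z_hat_holder3 S X N \<mu> T"
  defines "b \<equiv> germ (frozen_defect S \<tau> h)"
  shows "b \<in> sewing_domain X N \<mu> \<tau>"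
    and "ts \<in> time_simplex \<tau> 3 \<Longrightarrow> delta b ts = frozen_defect S \<tau> h ts"
    and "norm3 X N \<mu> \<tau> (delta b) \<le> semigroup_bound T X N S * norm3 X N \<mu> T h"
proof -
  have hc: "h \<in> cont_maps X N T 3" and fin: "norm3 X N \<mu> T h < \<infinity>"
    using h by (auto simp: Z_hat_holder3_def holder3_def)
  have kc: "frozen_defect S \<tau> h \<in> cont_maps X N \<tau> 3"
    using frozen_defect_cont[OF \<tau> _ hc] by simp
  show eq: "delta b ts = frozen_defect S \<tau> h ts" if "ts \<in> time_simplex \<tau> 3" for ts
    unfolding b_def by (rule delta_germ[OF _ that]) (rule delta_frozen_defect[OF \<tau> h])
  show le: "norm3 X N \<mu> \<tau> (delta b) \<le> semigroup_bound T X N S * norm3 X N \<mu> T h"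
    using norm3_frozen_defect_le[OF \<tau> fin] norm3_cong[OF eq] by simp
  also have "\<dots> < \<infinity>" using fin finite_bound by (simp add: ennreal_mult_less_top)
  finally show "b \<in> sewing_domain X N \<mu> \<tau>"
    using kc cont_maps_cong[OF eq] germ_cont[OF _ kc] \<tau>
    by (auto simp: sewing_domain_def holder3_def b_def)
qed

end

section \<open>Uniform estimates for the frozen increments\<close>

theorem theorem4p5:
  fixes T \<gamma> \<alpha> C\<gamma> C1 :: real
    and C\<epsilon> :: "real \<Rightarrow> real"
    and B :: "real \<Rightarrow> 'a::real_vector set"
    and nrm :: "real \<Rightarrow> 'a \<Rightarrow> real"
    and S :: "real \<Rightarrow> 'a \<Rightarrow> 'a"
    and J :: "real \<Rightarrow> (real list \<Rightarrow> 'a) \<Rightarrow> real list \<Rightarrow> 'a"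
    and h :: "real list \<Rightarrow> 'a"
  assumes "0 < T"
    and "banach_scale B nrm"
    and "\<And>\<beta>. analytic_semigroup_on (B \<beta>) (nrm \<beta>) S"
    and "smoothing_estimates T B nrm S"
    and "\<And>\<beta>. semigroup_bound T (B \<beta>) (nrm \<beta>) S < \<infinity>"
    and "0 < \<gamma>" and "\<gamma> \<le> 1"
    and "dyadic_sewing T (B \<alpha>) (nrm \<alpha>) \<gamma> C\<gamma> C1 C\<epsilon> J"
    and "h \<in> Z_hat_holder3 S (B \<alpha>) (nrm \<alpha>) \<gamma> T"
  shows "(\<gamma> < 1 \<longrightarrow>
            (\<forall>\<tau>\<in>{0..T}. frozen_increment S J \<tau> h \<in> holder2 (B \<alpha>) (nrm \<alpha>) \<gamma> \<tau>
               \<and> (\<forall>ts\<in>time_simplex \<tau> 3. delta (frozen_increment S J \<tau> h) ts = frozen_defect S \<tau> h ts))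
          \<and> (SUP \<tau>\<in>{0..T}. norm2 (nrm \<alpha>) \<gamma> \<tau> (frozen_increment S J \<tau> h))
              \<le> ennreal C\<gamma> * semigroup_bound T (B \<alpha>) (nrm \<alpha>) S * norm3 (B \<alpha>) (nrm \<alpha>) \<gamma> T h)
       \<and> (\<gamma> = 1 \<longrightarrow>
            (\<forall>\<tau>\<in>{0..T}. frozen_increment S J \<tau> h \<in> log_holder2 (B \<alpha>) (nrm \<alpha>) \<tau>
               \<and> (\<forall>ts\<in>time_simplex \<tau> 3. delta (frozen_increment S J \<tau> h) ts = frozen_defect S \<tau> h ts))
          \<and> (SUP \<tau>\<in>{0..T}. norm_log (nrm \<alpha>) \<tau> (frozen_increment S J \<tau> h))
              \<le> ennreal C1 * semigroup_bound T (B \<alpha>) (nrm \<alpha>) S * norm3 (B \<alpha>) (nrm \<alpha>) 1 T h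
          \<and> (\<forall>\<epsilon>\<in>{0<..<1}.
               (SUP \<tau>\<in>{0..T}. norm2 (nrm \<alpha>) (1 - \<epsilon>) \<tau> (frozen_increment S J \<tau> h))
                 \<le> ennreal (C\<epsilon> \<epsilon>) * semigroup_bound T (B \<alpha>) (nrm \<alpha>) S
                      * norm3 (B \<alpha>) (nrm \<alpha>) 1 T h))"
proof -
  have "banach_on (B \<alpha>) (nrm \<alpha>)" using assms(2) unfolding banach_scale_def by blast
  moreover have "C0_semigroup_on (B \<alpha>) (nrm \<alpha>) S"
    using assms(3)[of \<alpha>] unfolding analytic_semigroup_on_def by (rule conjunct1)
  ultimately interpret bounded_C0_semigroup T "B \<alpha>" "nrm \<alpha>" S
    using assms(5) by unfold_locales
  let ?M = "semigroup_bound T (B \<alpha>) (nrm \<alpha>) S"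
  let ?n3 = "norm3 (B \<alpha>) (nrm \<alpha>) \<gamma>"
  let ?b = "\<lambda>\<tau>. germ (frozen_defect S \<tau> h)"
  have r: "frozen_increment S J \<tau> h = remainder J \<tau> (?b \<tau>)" for \<tau>
    by (simp add: frozen_increment_def dyadic_Lambda_def)
  note b = frozen_germ[OF _ assms(9)]
  have bound: "x \<le> ennreal c * ?M * ?n3 T h"
    if "x \<le> ennreal c * ?n3 \<tau> (delta (?b \<tau>))" "\<tau> \<in> {0..T}" for x c \<tau>
    using order_trans[OF that(1) mult_left_mono[OF b(3)[OF that(2)]]] by (simp add: mult.assoc)
  have delta: "\<forall>ts\<in>time_simplex \<tau> 3. delta (frozen_increment S J \<tau> h) ts = frozen_defect S \<tau> h ts"
    if \<tau>: "\<tau> \<in> {0..T}" for \<tau>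
  proof -
    have "\<forall>ts\<in>time_simplex \<tau> 3. delta (remainder J \<tau> (?b \<tau>)) ts = delta (?b \<tau>) ts"
      using assms(8) \<tau> b(1)[OF \<tau>] unfolding dyadic_sewing_def by blast
    then show ?thesis using b(2)[OF \<tau>] by (simp add: r)
  qed
  have lt: "remainder J \<tau> (?b \<tau>) \<in> holder2 (B \<alpha>) (nrm \<alpha>) \<gamma> \<tau>
      \<and> norm2 (nrm \<alpha>) \<gamma> \<tau> (remainder J \<tau> (?b \<tau>)) \<le> ennreal C\<gamma> * ?n3 \<tau> (delta (?b \<tau>))"
    if "\<tau> \<in> {0..T}" "\<gamma> < 1" for \<tau>
    using assms(8) that b(1)[OF that(1)] unfolding dyadic_sewing_def by blast
  have eq: "remainder J \<tau> (?b \<tau>) \<in> log_holder2 (B \<alpha>) (nrm \<alpha>) \<tau>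
      \<and> norm_log (nrm \<alpha>) \<tau> (remainder J \<tau> (?b \<tau>)) \<le> ennreal C1 * ?n3 \<tau> (delta (?b \<tau>))
      \<and> (\<forall>\<epsilon>\<in>{0<..<1}. norm2 (nrm \<alpha>) (1 - \<epsilon>) \<tau> (remainder J \<tau> (?b \<tau>))
            \<le> ennreal (C\<epsilon> \<epsilon>) * ?n3 \<tau> (delta (?b \<tau>)))"
    if "\<tau> \<in> {0..T}" "\<gamma> = 1" for \<tau>
    using assms(8) that b(1)[OF that(1)] unfolding dyadic_sewing_def by blast
  show ?thesis
  proof (intro conjI impI ballI; (rule SUP_least)?)
    fix \<tau> assume "\<gamma> < 1" "\<tau> \<in> {0..T}"
    then show "norm2 (nrm \<alpha>) \<gamma> \<tau> (frozen_increment S J \<tau> h) \<le> ennreal C\<gamma> * ?M * ?n3 T h"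
      using lt bound r by metis
  next
    fix \<tau> assume "\<gamma> = 1" "\<tau> \<in> {0..T}"
    then show "norm_log (nrm \<alpha>) \<tau> (frozen_increment S J \<tau> h)
        \<le> ennreal C1 * ?M * norm3 (B \<alpha>) (nrm \<alpha>) 1 T h"
      using eq bound r by metis
  next
    fix \<epsilon> \<tau> assume "\<gamma> = 1" "\<epsilon> \<in> {0<..<1::real}" "\<tau> \<in> {0..T}"
    then show "norm2 (nrm \<alpha>) (1 - \<epsilon>) \<tau> (frozen_increment S J \<tau> h)
        \<le> ennreal (C\<epsilon> \<epsilon>) * ?M * norm3 (B \<alpha>) (nrm \<alpha>) 1 T h"
      using eq bound r by metis
  qed (use lt eq delta r in auto)
qed

end
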